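(* Let $u$ be a non-constant inner function in $H^\infty$, let $\eta\in\,]0,1[$, and let $\Omega:=\Omega_u(\eta)=\{z\in\mathbb D: |u(z)|<\eta\}$. Suppose that $\Omega_0$ is a connected component (maximal connected subset) of $\Omega$. Then: (1) $\Omega_0$ is a simply connected domain; that is, $\mathbb C\setminus\Omega_0$ has no bounded components. (2) $\inf_{\Omega_0}|u|=0$.
   Context: $\mathbb D$ is the open unit disk in $\mathbb C$. $H^\infty$ is the algebra of bounded holomorphic functions on $\mathbb D$. An inner function is a function $u\in H^\infty$ whose radial limits have modulus one almost everywhere on the unit circle. *)

theory Defs
  imports "HOL-Complex_Analysis.Complex_Analysis"
begin

abbreviation unit_disk :: "complex set" where
  "unit_disk \<equiv> ball 0 1"

definition H_infinity :: "(complex \<Rightarrow> complex) set" where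
  "H_infinity = {f. f holomorphic_on unit_disk \<and> bounded (f ` unit_disk)}"

definition has_radial_limit :: "(complex \<Rightarrow> complex) \<Rightarrow> complex \<Rightarrow> real \<Rightarrow> bool" where
  "has_radial_limit f L t \<longleftrightarrow> ((\<lambda>r. f (of_real r * cis t)) \<longlongrightarrow> L) (at_left 1)"

text \<open>Arc length on the unit circle is Lebesgue measure in the angle over one period.
  The existence of the radial limit at almost every point, which holds for every function in
  \<open>H_infinity\<close> by Fatou's theorem, is part of the condition.\<close>

definition inner_function :: "(complex \<Rightarrow> complex) \<Rightarrow> bool" where
  "inner_function u \<longleftrightarrow> u \<in> H_infinity \<and>
     (AE t in lebesgue_on {0..2*pi}. \<exists>L. has_radial_limit u L t \<and> norm L = 1)"

definition level_set :: "(complex \<Rightarrow> complex) \<Rightarrow> real \<Rightarrow> complex set" where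
  "level_set u \<eta> = {z \<in> unit_disk. norm (u z) < \<eta>}"

text \<open>The simple connectivity of a domain is recorded in both the homotopy form of the library and
  the form in which no component of the complement in the plane is bounded.\<close>

definition simply_connected_domain :: "complex set \<Rightarrow> bool" where
  "simply_connected_domain S \<longleftrightarrow> S \<noteq> {} \<and> open S \<and> connected S \<and> simply_connected S \<and>
     (\<forall>C \<in> components (- S). \<not> bounded C)"

end

theory Submission
  imports Defs
begin

text \<open>
  Both assertions come from the maximum principle, together with the fact that \<open>\<bar>u\<bar> = \<eta>\<close> at the
  points of the disk on the boundary of the component \<open>\<Omega>\<close>.

  For simple connectivity, fill the holes of \<open>\<Omega>\<close>. The complement of the disk is connected, so it
  lies in a single component \<open>K\<close> of the complement of \<open>\<Omega>\<close>, and every other component is a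
  compact subset of the disk whose boundary lies in that of \<open>\<Omega>\<close>. Hence \<open>\<bar>u\<bar> \<le> \<eta>\<close> on the
  complement of \<open>K\<close>, which is open and connected; as \<open>u\<close> is not constant, \<open>\<bar>u\<bar> < \<eta>\<close> there.
  By maximality that complement is \<open>\<Omega>\<close> itself, so \<open>\<Omega>\<close> has no holes.

  For the infimum, suppose that \<open>\<bar>u\<bar>\<close> is bounded away from \<open>0\<close> on \<open>\<Omega>\<close>. The function equal to
  \<open>\<eta>/\<bar>u\<bar> - 1\<close> on \<open>\<Omega>\<close> and to \<open>0\<close> elsewhere is then bounded, continuous and subharmonic on the
  whole disk, and strictly positive on \<open>\<Omega>\<close>. Since the radial limits of \<open>u\<close> have modulus
  \<open>1 > \<eta>\<close>, almost every radius eventually leaves \<open>\<Omega>\<close>, so this function has radial limits \<open>0\<close>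
  almost everywhere. Extending by \<open>0\<close> is what makes this work: the closure of \<open>\<Omega>\<close> may meet the
  circle in a set of positive measure, so there is no direct comparison on the boundary of
  \<open>\<Omega>\<close>. By dominated convergence its integrals over the circles of radius \<open>r\<close> tend to \<open>0\<close> as
  \<open>r\<close> tends to \<open>1\<close>; they are nonnegative and increase with \<open>r\<close> (lemma \<open>circle_integral_mono\<close>), so they
  all vanish, and the function is identically \<open>0\<close>, a contradiction.

  Circle integrals increase for the following reason. The average of a subharmonic function over finitely many rotations still obeys the
  maximum principle, and as the number of rotations grows it approaches the circle mean, uniformly
  on compact subsets of the disk.
\<close>

section \<open>The maximum principle for functions with harmonic minorants\<close>

text \<open>
  A form of subharmonicity: every point has a neighbourhood on which some harmonic function is
  at most \<open>v\<close> and agrees with it at the point. It passes to sums and rotations at once, it yields the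
  maximum principle, and for \<open>\<eta>/\<bar>u\<bar> - 1\<close> extended by \<open>0\<close> outside a component the minorants
  can be written down. The neighbourhoods may shrink from point to point, so only finite sums are considered.
\<close>

definition harmonic_minorants :: "(complex \<Rightarrow> real) \<Rightarrow> complex set \<Rightarrow> bool" where
  "harmonic_minorants v U \<longleftrightarrow>
     (\<forall>z\<in>U. \<exists>e>0. \<exists>F. ball z e \<subseteq> U \<and> F holomorphic_on ball z e \<and> Re (F z) = v z \<and>
        (\<forall>w\<in>ball z e. Re (F w) \<le> v w))"

lemma harmonic_minorantsE:
  assumes "harmonic_minorants v U" "z \<in> U"
  obtains e F where "e > 0" "ball z e \<subseteq> U" "F holomorphic_on ball z e" "Re (F z) = v z"
    "\<And>w. w \<in> ball z e \<Longrightarrow> Re (F w) \<le> v w"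
  using assms unfolding harmonic_minorants_def by meson

lemma harmonic_minorants_subset:
  assumes "harmonic_minorants v U" "open V" "V \<subseteq> U"
  shows "harmonic_minorants v V"
  unfolding harmonic_minorants_def
proof
  fix z assume z: "z \<in> V"
  then obtain e F where F: "e > 0" "F holomorphic_on ball z e" "Re (F z) = v z"
    "\<And>w. w \<in> ball z e \<Longrightarrow> Re (F w) \<le> v w"
    using harmonic_minorantsE[OF assms(1)] assms(3) by (metis subsetD)
  obtain d where d: "d > 0" "ball z d \<subseteq> V"
    using assms(2) z open_contains_ball by blast
  show "\<exists>e>0. \<exists>F. ball z e \<subseteq> V \<and> F holomorphic_on ball z e \<and> Re (F z) = v z \<and>
        (\<forall>w\<in>ball z e. Re (F w) \<le> v w)"
    by (rule exI[of _ "min e d"])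
      (use F d in \<open>auto intro!: exI[of _ F] elim: holomorphic_on_subset\<close>)
qed

lemma harmonic_minorants_sum:
  assumes "finite I" "open U" "\<And>i. i \<in> I \<Longrightarrow> harmonic_minorants (v i) U"
  shows "harmonic_minorants (\<lambda>z. \<Sum>i\<in>I. v i z) U"
  using assms(1,3)
proof (induction I rule: finite_induct)
  case empty
  show ?case
    unfolding harmonic_minorants_def
  proof
    fix z assume "z \<in> U"
    then obtain e where "e > 0" "ball z e \<subseteq> U"
      using assms(2) open_contains_ball by blast
    then show "\<exists>e>0. \<exists>F. ball z e \<subseteq> U \<and> F holomorphic_on ball z e \<and>
        Re (F z) = (\<Sum>i\<in>{}. v i z) \<and> (\<forall>w\<in>ball z e. Re (F w) \<le> (\<Sum>i\<in>{}. v i w))"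
      by (intro exI[of _ e] conjI exI[of _ "\<lambda>_. 0"]) auto
  qed
next
  case (insert i I)
  have hs: "harmonic_minorants (\<lambda>z. \<Sum>i\<in>I. v i z) U" and hi: "harmonic_minorants (v i) U"
    using insert by auto
  show ?case
    unfolding harmonic_minorants_def
  proof
    fix z assume z: "z \<in> U"
    obtain e F where F: "e > 0" "ball z e \<subseteq> U" "F holomorphic_on ball z e"
      "Re (F z) = (\<Sum>i\<in>I. v i z)" "\<And>w. w \<in> ball z e \<Longrightarrow> Re (F w) \<le> (\<Sum>i\<in>I. v i w)"
      using harmonic_minorantsE[OF hs z] by metis
    obtain d G where G: "d > 0" "ball z d \<subseteq> U" "G holomorphic_on ball z d"
      "Re (G z) = v i z" "\<And>w. w \<in> ball z d \<Longrightarrow> Re (G w) \<le> v i w"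
      using harmonic_minorantsE[OF hi z] by metis
    have "F holomorphic_on ball z (min e d)" "G holomorphic_on ball z (min e d)"
      using F(3) G(3) by (auto elim: holomorphic_on_subset)
    then have "(\<lambda>w. F w + G w) holomorphic_on ball z (min e d)"
      by (intro holomorphic_intros)
    then show "\<exists>e>0. \<exists>F. ball z e \<subseteq> U \<and> F holomorphic_on ball z e \<and>
        Re (F z) = (\<Sum>i\<in>insert i I. v i z) \<and>
        (\<forall>w\<in>ball z e. Re (F w) \<le> (\<Sum>i\<in>insert i I. v i w))"
      using F G insert.hyps
      by (intro exI[of _ "min e d"] conjI exI[of _ "\<lambda>w. F w + G w"])
        (auto intro!: add_mono simp: add.commute[of "v i _"])
  qed
qed

lemma harmonic_minorants_rotate:
  assumes "harmonic_minorants v (ball 0 R)" "norm c = 1"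
  shows "harmonic_minorants (\<lambda>z. v (z * c)) (ball 0 R)"
  unfolding harmonic_minorants_def
proof
  fix z :: complex assume z: "z \<in> ball 0 R"
  have "z * c \<in> ball 0 R"
    using z assms(2) by (simp add: norm_mult)
  then obtain e F where F: "e > 0" "ball (z * c) e \<subseteq> ball 0 R" "F holomorphic_on ball (z * c) e"
    "Re (F (z * c)) = v (z * c)" "\<And>w. w \<in> ball (z * c) e \<Longrightarrow> Re (F w) \<le> v w"
    using harmonic_minorantsE[OF assms(1)] by metis
  have rot: "w * c \<in> ball (z * c) e" if "w \<in> ball z e" for w
    using that assms(2) by (simp add: dist_norm norm_mult flip: left_diff_distrib)
  have "ball z e \<subseteq> ball 0 R"
    using rot F(2) assms(2) by (force simp: norm_mult)
  moreover have "(F \<circ> (\<lambda>w. w * c)) holomorphic_on ball z e"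
    by (rule holomorphic_on_compose_gen[OF _ F(3)]) (use rot in \<open>auto intro!: holomorphic_intros\<close>)
  ultimately show "\<exists>e>0. \<exists>F. ball z e \<subseteq> ball 0 R \<and> F holomorphic_on ball z e \<and>
      Re (F z) = v (z * c) \<and> (\<forall>w\<in>ball z e. Re (F w) \<le> v (w * c))"
    using F rot by (intro exI[of _ e] conjI exI[of _ "F \<circ> (\<lambda>w. w * c)"]) auto
qed

text \<open>
  At an interior maximum of \<open>v\<close> the touching minorant has a maximum too, so it is constant, and \<open>v\<close>
  is squeezed between it and the maximal value. Hence the set where the maximum is attained is open
  as well as closed in the disk; once it meets the disk it fills it, and by continuity reaches the
  circle.
\<close>

lemma harmonic_minorants_maximum:
  fixes v :: "complex \<Rightarrow> real"
  assumes "harmonic_minorants v (ball 0 r)" "continuous_on (cball 0 r) v" "norm z \<le> r"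
  obtains w where "norm w = r" "v z \<le> v w"
proof -
  have "z \<in> cball 0 r" using assms(3) by simp
  then obtain p where p: "p \<in> cball 0 r" "\<And>x. x \<in> cball 0 r \<Longrightarrow> v x \<le> v p"
    using continuous_attains_sup[of "cball 0 r" v] assms(2) by (metis compact_cball empty_iff)
  show thesis
  proof (cases "norm p = r")
    case True
    then show ?thesis using that p(2) \<open>z \<in> cball 0 r\<close> by blast
  next
    case False
    then have pb: "p \<in> ball 0 r" using p(1) by simp
    then have r: "r > 0" by (metis mem_ball_0 norm_ge_zero order_le_less_trans)
    define S where "S = {x \<in> ball 0 r. v x = v p}"
    have "open S"
      unfolding open_contains_ball
    proof
      fix x assume "x \<in> S"
      then have x: "x \<in> ball 0 r" "v x = v p" by (auto simp: S_def)
      obtain e F where F: "e > 0" "ball x e \<subseteq> ball 0 r" "F holomorphic_on ball x e"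
        "Re (F x) = v x" "\<And>w. w \<in> ball x e \<Longrightarrow> Re (F w) \<le> v w"
        using harmonic_minorantsE[OF assms(1) x(1)] by metis
      have max: "v w \<le> v p" if "w \<in> ball x e" for w
        using that F(2) p(2) ball_subset_cball by blast
      \<comment> \<open>Exponentiating turns a maximum of the real part into one of the modulus.\<close>
      have "(\<lambda>w. exp (F w)) constant_on ball x e"
      proof (rule maximum_modulus_principle[where U = "ball x e" and \<xi> = x])
        show "(\<lambda>w. exp (F w)) holomorphic_on ball x e"
          using F(3) by (intro holomorphic_intros)
        show "norm (exp (F w)) \<le> norm (exp (F x))" if "w \<in> ball x e" for w
          using F(4) F(5)[OF that] max[OF that] x(2) by simp
      qed (use F(1) in auto)
      then have "exp (F w) = exp (F x)" if "w \<in> ball x e" for w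
        using that F(1) unfolding constant_on_def by (metis centre_in_ball)
      then have "Re (F w) = Re (F x)" if "w \<in> ball x e" for w
        using that by (metis exp_eq_1 exp_inj_iff norm_exp_eq_Re)
      then have "v w = v p" if "w \<in> ball x e" for w
        using F(4) F(5)[OF that] max[OF that] x(2) that by (intro order_antisym) auto
      then have "ball x e \<subseteq> S"
        using F(2) unfolding S_def by blast
      then show "\<exists>e>0. ball x e \<subseteq> S" using F(1) by blast
    qed
    then have "openin (top_of_set (ball 0 r)) S"
      by (intro open_subset) (auto simp: S_def)
    moreover have "closedin (top_of_set (ball 0 r)) S"
      unfolding S_def
      by (intro continuous_closedin_preimage_constant continuous_on_subset[OF assms(2)]) auto
    ultimately have "S = ball 0 r"
      using connected_clopen[of "ball 0 r"] pb unfolding S_def by auto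
    then have const: "v x = v p" if "x \<in> ball 0 r" for x
      using that unfolding S_def by blast
    have "v (of_real r) = v p"
    proof (rule continuous_constant_on_closure[of "ball 0 r" v])
      show "continuous_on (closure (ball 0 r)) v" using assms(2) r by simp
      show "v x = v p" if "x \<in> ball 0 r" for x using const[OF that] .
      show "complex_of_real r \<in> closure (ball 0 r)" using r by simp
    qed
    then show ?thesis
      using that[of "of_real r"] r p(2) \<open>z \<in> cball 0 r\<close> by auto
  qed
qed

section \<open>Circle means\<close>

lemma Riemann_sum_error:
  fixes f :: "real \<Rightarrow> real"
  assumes "continuous_on UNIV f" "0 \<le> d" "\<And>s t. \<bar>s - t\<bar> \<le> d \<Longrightarrow> \<bar>f s - f t\<bar> \<le> e"
  shows "\<bar>integral {0..real n * d} f - d * (\<Sum>k<n. f (real k * d))\<bar> \<le> real n * d * e"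
proof (induction n)
  case 0
  then show ?case by simp
next
  case (Suc n)
  let ?a = "real n * d" and ?b = "real (Suc n) * d"
  have int: "f integrable_on {s..t}" for s t
    by (intro integrable_continuous_real continuous_on_subset[OF assms(1)]) auto
  have ab: "0 \<le> ?a" "?a \<le> ?b" "?b - ?a = d"
    using assms(2) by (auto simp: algebra_simps)
  have split: "integral {0..?b} f = integral {0..?a} f + integral {?a..?b} f"
    using Henstock_Kurzweil_Integration.integral_combine[OF ab(1,2) int] by simp
  have "norm (integral {?a..?b} (\<lambda>t. f t - f ?a)) \<le> e * (?b - ?a)"
    using ab assms(3) by (intro integral_bound continuous_intros continuous_on_subset[OF assms(1)]) auto
  moreover have "integral {?a..?b} (\<lambda>t. f t - f ?a) = integral {?a..?b} f - d * f ?a"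
    using ab by (subst Henstock_Kurzweil_Integration.integral_diff[OF int]) auto
  ultimately have "\<bar>integral {?a..?b} f - d * f ?a\<bar> \<le> e * d"
    using ab(3) by simp
  then show ?case
    unfolding split using Suc.IH by (simp add: algebra_simps)
qed

lemma integral_period_shift:
  fixes f :: "real \<Rightarrow> real"
  assumes "continuous_on UNIV f" "\<And>t. f (t + p) = f t" "0 \<le> a" "a \<le> p"
  shows "integral {0..p} (\<lambda>t. f (t + a)) = integral {0..p} f"
proof -
  have int: "f integrable_on {s..t}" for s t
    by (intro integrable_continuous_real continuous_on_subset[OF assms(1)]) auto
  have "integral {0..p} (\<lambda>t. f (t + a)) = integral {a..p + a} f"
    using integral_shift_real_ivl[of a a "p + a" f] by simp
  also have "\<dots> = integral {a..p} f + integral {p..p + a} f"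
    using Henstock_Kurzweil_Integration.integral_combine[of a p "p + a" f] int assms(3,4) by simp
  also have "integral {p..p + a} f = integral {0..a} f"
    using integral_shift_real_ivl[of p p "p + a" f] assms(2) by simp
  also have "integral {a..p} f + integral {0..a} f = integral {0..p} f"
    using Henstock_Kurzweil_Integration.integral_combine[of 0 a p f] int assms(3,4) by simp
  finally show ?thesis .
qed

lemma norm_cis_diff_le: "norm (cis s - cis t) \<le> \<bar>s - t\<bar>"
proof -
  have "cis s - cis t = cis t * (exp (\<i> * of_real (s - t)) - 1)"
    by (simp add: algebra_simps cis_conv_exp exp_diff exp_minus divide_simps)
  then have "norm (cis s - cis t) = 2 * \<bar>sin ((s - t) / 2)\<bar>"
    by (simp add: norm_mult dist_exp_i_1 del: of_real_diff)
  also have "\<dots> \<le> \<bar>s - t\<bar>"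
    using abs_sin_x_le_abs_x[of "(s - t) / 2"] by simp
  finally show ?thesis .
qed

lemma continuous_on_circle:
  fixes v :: "complex \<Rightarrow> real"
  assumes "continuous_on (ball 0 R) v" "norm z < R"
  shows "continuous_on A (\<lambda>t. v (z * cis t))"
  by (rule continuous_on_compose2[OF assms(1)])
    (use assms(2) in \<open>auto intro!: continuous_intros simp: norm_mult\<close>)

lemma circle_integral_rotate:
  fixes v :: "complex \<Rightarrow> real"
  assumes "continuous_on (ball 0 R) v" "norm z < R"
  shows "integral {0..2*pi} (\<lambda>t. v (z * cis t)) = integral {0..2*pi} (\<lambda>t. v (of_real (norm z) * cis t))"
proof -
  have z: "z = of_real (norm z) * cis (Arg2pi z)"
    using Arg2pi[of z] by (simp add: is_Arg_def cis_conv_exp)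
  have "integral {0..2*pi} (\<lambda>t. v (of_real (norm z) * cis (t + Arg2pi z)))
      = integral {0..2*pi} (\<lambda>t. v (of_real (norm z) * cis t))"
    by (rule integral_period_shift)
      (use Arg2pi[of z] assms in \<open>auto intro!: continuous_on_circle[of R] simp flip: cis_mult\<close>)
  moreover have "of_real (norm z) * cis (t + Arg2pi z) = z * cis t" for t
    by (subst (2) z) (simp add: cis_mult add.commute mult.assoc)
  ultimately show ?thesis by simp
qed

text \<open>
  Apply the maximum principle to the sum of \<open>v\<close> over the \<open>n\<close> rotations by multiples of \<open>2\<pi>/n\<close>.
  Times \<open>2\<pi>/n\<close> these are Riemann sums of the circle integrals, with an error uniform on the closed
  disk of radius \<open>r\<close>. The point where the maximum over the circle is attained depends on \<open>n\<close>, but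
  the circle integral does not distinguish points of equal modulus.
\<close>

lemma circle_integral_mono:
  fixes v :: "complex \<Rightarrow> real"
  assumes v: "harmonic_minorants v (ball 0 R)" "continuous_on (ball 0 R) v"
    and zr: "norm z \<le> r" "r < R"
  shows "integral {0..2*pi} (\<lambda>t. v (z * cis t)) \<le> integral {0..2*pi} (\<lambda>t. v (of_real r * cis t))"
proof (rule field_le_epsilon)
  fix e :: real assume e: "e > 0"
  define \<epsilon> where "\<epsilon> = e / (4 * pi)"
  have \<epsilon>: "\<epsilon> > 0" using e by (simp add: \<epsilon>_def)
  have sub: "cball 0 r \<subseteq> ball 0 R" using zr by auto
  have "uniformly_continuous_on (cball 0 r) v"
    by (intro compact_uniformly_continuous continuous_on_subset[OF v(2) sub]) auto
  then obtain d where d: "d > 0"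
    "\<And>x y. x \<in> cball 0 r \<Longrightarrow> y \<in> cball 0 r \<Longrightarrow> dist x y < d \<Longrightarrow> dist (v x) (v y) < \<epsilon>"
    using \<epsilon> unfolding uniformly_continuous_on_def by (metis dist_commute)
  obtain n :: nat where n: "real n > max 1 ((2 * pi + r) * 2 * pi / d)"
    using reals_Archimedean2 by blast
  define h where "h = 2 * pi / real n"
  have n0: "n > 0" using n by auto
  have h: "h > 0" "real n * h = 2 * pi" using n0 by (auto simp: h_def)
  have r0: "r \<ge> 0" using zr(1) norm_ge_zero order_trans by blast
  have rh: "r * h < d"
  proof -
    have "r * 2 * pi / d \<le> (2 * pi + r) * 2 * pi / d"
      using d(1) by (simp add: divide_right_mono mult_right_mono)
    then have "r * 2 * pi / d < real n" using n by linarith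
    then show ?thesis using d(1) n0 by (simp add: h_def field_simps)
  qed
  \<comment> \<open>The sampling error is the same for all circles of radius at most \<open>r\<close>.\<close>
  have sample: "\<bar>integral {0..2*pi} (\<lambda>t. v (w * cis t)) - h * (\<Sum>k<n. v (w * cis (real k * h)))\<bar> \<le> e / 2"
    if w: "norm w \<le> r" for w
  proof -
    have "\<bar>integral {0..real n * h} (\<lambda>t. v (w * cis t)) - h * (\<Sum>k<n. v (w * cis (real k * h)))\<bar>
        \<le> real n * h * \<epsilon>"
    proof (rule Riemann_sum_error)
      show "continuous_on UNIV (\<lambda>t. v (w * cis t))"
        using w zr by (intro continuous_on_circle[OF v(2)]) auto
      fix s t :: real assume st: "\<bar>s - t\<bar> \<le> h"
      have "dist (w * cis s) (w * cis t) = norm w * norm (cis s - cis t)"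
        by (simp add: dist_norm norm_mult flip: right_diff_distrib)
      also have "\<dots> \<le> r * h"
        using w st norm_cis_diff_le[of s t] r0 by (intro mult_mono) auto
      finally have "dist (w * cis s) (w * cis t) < d" using rh by simp
      then have "dist (v (w * cis s)) (v (w * cis t)) < \<epsilon>"
        using w by (intro d(2)) (auto simp: norm_mult)
      then show "\<bar>v (w * cis s) - v (w * cis t)\<bar> \<le> \<epsilon>"
        by (simp add: dist_real_def)
    qed (use h in auto)
    then show ?thesis using h by (simp add: \<epsilon>_def)
  qed
  let ?M = "\<lambda>w. \<Sum>k<n. v (w * cis (real k * h))"
  have "harmonic_minorants ?M (ball 0 R)"
    by (intro harmonic_minorants_sum harmonic_minorants_rotate v(1)) auto
  then have hM: "harmonic_minorants ?M (ball 0 r)"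
    by (rule harmonic_minorants_subset) (use zr in auto)
  have cM: "continuous_on (cball 0 r) ?M"
    using zr by (intro continuous_intros continuous_on_compose2[OF v(2)]) (auto simp: norm_mult)
  obtain w where w: "norm w = r" "?M z \<le> ?M w"
    using harmonic_minorants_maximum[OF hM cM zr(1)] by blast
  have "integral {0..2*pi} (\<lambda>t. v (z * cis t)) \<le> h * ?M z + e / 2"
    using sample[OF zr(1)] by linarith
  also have "\<dots> \<le> h * ?M w + e / 2"
    using w(2) h(1) by simp
  also have "\<dots> \<le> integral {0..2*pi} (\<lambda>t. v (w * cis t)) + e"
    using sample[of w] w(1) by linarith
  also have "integral {0..2*pi} (\<lambda>t. v (w * cis t)) = integral {0..2*pi} (\<lambda>t. v (of_real r * cis t))"
    using circle_integral_rotate[OF v(2), of w] w(1) zr by simp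
  finally show "integral {0..2*pi} (\<lambda>t. v (z * cis t))
      \<le> integral {0..2*pi} (\<lambda>t. v (of_real r * cis t)) + e" .
qed

text \<open>
  A maximum principle for boundary values prescribed almost everywhere. The bound is essential: the Poisson kernel has radial limit \<open>0\<close> at all points of the circle but one.
\<close>

lemma radial_limit_zero_imp_zero:
  fixes v :: "complex \<Rightarrow> real"
  assumes v: "harmonic_minorants v unit_disk" "continuous_on unit_disk v"
    and bound: "\<And>z. z \<in> unit_disk \<Longrightarrow> 0 \<le> v z \<and> v z \<le> B"
    and lim: "AE t in lebesgue_on {0..2*pi}. ((\<lambda>r. v (of_real r * cis t)) \<longlongrightarrow> 0) (at_left 1)"
    and z: "z \<in> unit_disk"
  shows "v z = 0"
proof -
  \<comment> \<open>Dominated convergence is used along a sequence of radii that approach \<open>1\<close> from below.\<close>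
  define r :: "nat \<Rightarrow> real" where "r n = 1 - inverse (real (Suc n))" for n
  have r01: "0 \<le> r n" "r n < 1" for n
    by (auto simp: r_def divide_simps)
  have rlim: "r \<longlonglongrightarrow> 1"
    unfolding r_def using tendsto_diff[OF tendsto_const LIMSEQ_inverse_real_of_nat, of 1] by simp
  then have rleft: "filterlim r (at_left 1) sequentially"
    by (intro tendsto_imp_filterlim_at_left) (use r01 in auto)
  have cont: "continuous_on A (\<lambda>t. v (of_real (r n) * cis t))" for n A
    by (rule continuous_on_circle[OF v(2)]) (use r01 in simp)
  have "(\<lambda>n. integral\<^sup>L (lebesgue_on {0..2*pi}) (\<lambda>t. v (of_real (r n) * cis t)))
      \<longlonglongrightarrow> integral\<^sup>L (lebesgue_on {0..2*pi}) (\<lambda>t. 0)"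
  proof (rule integral_dominated_convergence[where w = "\<lambda>_. B"])
    show "integrable (lebesgue_on {0..2*pi}) (\<lambda>_. B)"
      by (intro continuous_imp_integrable_real continuous_intros)
    show "AE t in lebesgue_on {0..2*pi}. (\<lambda>n. v (of_real (r n) * cis t)) \<longlonglongrightarrow> 0"
      using lim by eventually_elim (rule filterlim_compose[OF _ rleft])
    show "AE t in lebesgue_on {0..2*pi}. norm (v (of_real (r n) * cis t)) \<le> B" for n
      using r01[of n] bound by (intro AE_I2) (auto simp: norm_mult)
  qed (auto intro: borel_measurable_integrable continuous_imp_integrable_real cont)
  moreover have "integral\<^sup>L (lebesgue_on {0..2*pi}) (\<lambda>t. v (of_real (r n) * cis t))
      = integral {0..2*pi} (\<lambda>t. v (of_real (r n) * cis t))" for n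
    by (intro lebesgue_integral_eq_integral continuous_imp_integrable_real cont) auto
  ultimately have mlim: "(\<lambda>n. integral {0..2*pi} (\<lambda>t. v (of_real (r n) * cis t))) \<longlonglongrightarrow> 0"
    by simp
  have nz: "norm z < 1" using z by simp
  have "eventually (\<lambda>n. norm z < r n) sequentially"
    using order_tendstoD(1)[OF rlim nz] .
  then have "eventually (\<lambda>n. integral {0..2*pi} (\<lambda>t. v (z * cis t))
      \<le> integral {0..2*pi} (\<lambda>t. v (of_real (r n) * cis t))) sequentially"
    by eventually_elim (intro circle_integral_mono[OF v], use r01 in auto)
  then have "integral {0..2*pi} (\<lambda>t. v (z * cis t)) \<le> 0"
    using tendsto_lowerbound[OF mlim] by simp
  moreover have nonneg: "0 \<le> v (z * cis t)" for t
    using bound[of "z * cis t"] nz by (simp add: norm_mult)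
  moreover have cz: "continuous_on {0..2*pi} (\<lambda>t. v (z * cis t))"
    by (rule continuous_on_circle[OF v(2) nz])
  ultimately have "integral {0..2*pi} (\<lambda>t. v (z * cis t)) = 0"
    by (intro order_antisym integral_nonneg integrable_continuous_real) auto
  then have "v (z * cis 0) = 0"
    using integral_eq_0_iff[OF cz] nonneg by force
  then show ?thesis by simp
qed

section \<open>Components of level sets\<close>

text \<open>
  A boundary point with \<open>\<bar>u\<bar> < \<eta>\<close> would have a connected neighbourhood inside the level set that
  meets \<open>\<Omega>\<close>, and maximality would put it in the interior of \<open>\<Omega>\<close>.
\<close>

lemma component_frontier_norm:
  assumes u: "continuous_on unit_disk u" and \<Omega>: "\<Omega> \<in> components (level_set u \<eta>)"
    and z: "z \<in> unit_disk" "z \<in> frontier \<Omega>"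
  shows "norm (u z) = \<eta>"
proof (rule order_antisym)
  have sub: "\<Omega> \<subseteq> level_set u \<eta>" using \<Omega> in_components_subset by blast
  have at: "isCont u z" using u z(1) continuous_on_eq_continuous_at open_ball by blast
  then have atn: "(\<lambda>w. norm (u w)) \<midarrow>z\<rightarrow> norm (u z)"
    by (simp add: isCont_def tendsto_norm)
  show "norm (u z) \<le> \<eta>"
  proof (rule ccontr)
    assume "\<not> norm (u z) \<le> \<eta>"
    then have "eventually (\<lambda>w. norm (u w) > \<eta>) (nhds z)"
      using order_tendstoD(1)[OF atn, of \<eta>] by (auto simp: eventually_at_filter elim: eventually_mono)
    then obtain T where T: "open T" "z \<in> T" "\<And>w. w \<in> T \<Longrightarrow> norm (u w) > \<eta>"
      unfolding eventually_nhds by blast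
    moreover have "z \<in> closure \<Omega>" using z(2) by (simp add: frontier_def)
    ultimately obtain w where "w \<in> T" "w \<in> \<Omega>"
      using open_Int_closure_eq_empty[of T \<Omega>] by blast
    then show False using sub T(3)[of w] by (auto simp: level_set_def)
  qed
  show "\<eta> \<le> norm (u z)"
  proof (rule ccontr)
    assume "\<not> \<eta> \<le> norm (u z)"
    then have "eventually (\<lambda>w. norm (u w) < \<eta>) (nhds z)"
      using order_tendstoD(2)[OF atn, of \<eta>] by (auto simp: eventually_at_filter elim: eventually_mono)
    moreover have "eventually (\<lambda>w. w \<in> unit_disk) (nhds z)"
      using z(1) by (intro eventually_nhds_in_open) auto
    ultimately have "eventually (\<lambda>w. w \<in> level_set u \<eta>) (nhds z)"
      by eventually_elim (auto simp: level_set_def)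
    then obtain e where e: "e > 0" "ball z e \<subseteq> level_set u \<eta>"
      unfolding eventually_nhds_metric by (metis dist_commute mem_ball subsetI)
    obtain w where "w \<in> \<Omega>" "dist w z < e"
      using z(2) e(1) by (auto simp: frontier_def closure_approachable)
    then have "w \<in> \<Omega> \<inter> ball z e" by (simp add: dist_commute)
    then have "ball z e \<subseteq> \<Omega>"
      using components_maximal[OF \<Omega> connected_ball e(2)] by blast
    then have "z \<in> interior \<Omega>"
      using e(1) mem_interior by blast
    then show False using z(2) by (simp add: frontier_def)
  qed
qed

lemma open_level_set:
  assumes "continuous_on unit_disk u"
  shows "open (level_set u \<eta>)"
proof -
  have "level_set u \<eta> = unit_disk \<inter> (\<lambda>z. norm (u z)) -` {..<\<eta>}"
    by (auto simp: level_set_def)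
  then show ?thesis
    using continuous_open_preimage[OF continuous_on_norm[OF assms], of "{..<\<eta>}"] by auto
qed

text \<open>
  Filling the holes of \<open>\<Omega>\<close> keeps it connected and, by the maximum modulus principle, inside the
  level set, so maximality leaves no holes to fill.
\<close>

lemma level_set_component_simply_connected:
  assumes u: "u holomorphic_on unit_disk" "\<not> u constant_on unit_disk"
    and \<Omega>: "\<Omega> \<in> components (level_set u \<eta>)"
  shows "simply_connected_domain \<Omega>"
proof -
  have cu: "continuous_on unit_disk u" by (rule holomorphic_on_imp_continuous_on[OF u(1)])
  have op: "open \<Omega>" using open_components[OF open_level_set[OF cu] \<Omega>] .
  have conn: "connected \<Omega>" and ne: "\<Omega> \<noteq> {}" using \<Omega> in_components_connected in_components_nonempty by auto
  have sub: "\<Omega> \<subseteq> level_set u \<eta>" using \<Omega> in_components_subset by blast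
  then have subD: "\<Omega> \<subseteq> unit_disk" by (auto simp: level_set_def)
  have outconn: "connected (- unit_disk)"
    using connected_complement_bounded_convex[of unit_disk] by auto
  have "- unit_disk \<subseteq> - \<Omega>" using subD by blast
  moreover have "1 \<in> - unit_disk" by simp
  ultimately obtain K where K: "K \<in> components (- \<Omega>)" "- unit_disk \<subseteq> K"
    using exists_component_superset[OF _ _ outconn, of "- \<Omega>"] by blast
  \<comment> \<open>\<open>W\<close> is \<open>\<Omega>\<close> with its holes filled.\<close>
  define W where "W = - K"
  have W: "open W" "connected W" "W \<subseteq> unit_disk" "\<Omega> \<subseteq> W"
    using closed_components[OF _ K(1)] op component_complement_connected[OF conn K(1)] K
      in_components_subset[OF K(1)] by (auto simp: W_def)
  have le: "norm (u w) \<le> \<eta>" if w: "w \<in> W" for w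
  proof (cases "w \<in> \<Omega>")
    case True
    then show ?thesis using sub by (auto simp: level_set_def)
  next
    case False
    then have "w \<in> \<Union>(components (- \<Omega>))"
      unfolding Union_components by simp
    then obtain C where C: "C \<in> components (- \<Omega>)" "w \<in> C"
      by blast
    have "C \<inter> K = {}" using components_nonoverlap[OF C(1) K(1)] C(2) w by (auto simp: W_def)
    then have CD: "C \<subseteq> unit_disk" using K(2) by auto
    have clC: "closed C" using closed_components[OF _ C(1)] op by auto
    show ?thesis
    proof (rule maximum_modulus_frontier[of u C])
      show "u holomorphic_on interior C"
        using CD interior_subset by (blast intro: holomorphic_on_subset[OF u(1)])
      show "continuous_on (closure C) u"
        using CD clC by (simp add: continuous_on_subset[OF cu])
      show "bounded C" using CD bounded_subset bounded_ball by blast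
      show "norm (u z) \<le> \<eta>" if "z \<in> frontier C" for z
      proof -
        have "z \<in> frontier \<Omega>" using that frontier_of_components_subset[OF C(1)] by auto
        moreover have "z \<in> unit_disk" using that CD clC frontier_subset_closed by blast
        ultimately show ?thesis using component_frontier_norm[OF cu \<Omega>] by simp
      qed
    qed (fact C(2))
  qed
  have "norm (u w) < \<eta>" if w: "w \<in> W" for w
  proof (rule ccontr)
    assume "\<not> norm (u w) < \<eta>"
    then have "u constant_on unit_disk"
      using le w W(1,3)
      by (intro maximum_modulus_principle[OF u(1), where U = W and \<xi> = w]) force+
    then show False using u(2) by simp
  qed
  then have "W \<subseteq> level_set u \<eta>" using W(3) by (auto simp: level_set_def)
  then have "W \<subseteq> \<Omega>" using components_maximal[OF \<Omega> W(2)] W(4) ne by blast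
  then have "- \<Omega> = K" using W(4) by (auto simp: W_def)
  then have "components (- \<Omega>) = {K}"
    using in_components_connected[OF K(1)] in_components_nonempty[OF K(1)] components_eq_sing_iff
    by metis
  moreover have "\<not> bounded K"
    using K(2) cobounded_imp_unbounded[of "- unit_disk"] bounded_subset by auto
  ultimately have "\<forall>C\<in>components (- \<Omega>). \<not> bounded C" by simp
  then show ?thesis
    using op conn ne simply_connected_eq_unbounded_complement_components[OF op]
    by (simp add: simply_connected_domain_def)
qed

text \<open>
  Were the infimum positive, \<open>\<eta>/\<bar>u\<bar> - 1\<close> extended by \<open>0\<close> outside \<open>\<Omega>\<close> would be a bounded
  function to which \<open>radial_limit_zero_imp_zero\<close> applies, although it is positive on \<open>\<Omega>\<close>.
\<close>

lemma level_set_component_INF_zero: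
  assumes u: "inner_function u" and \<eta>: "0 < \<eta>" "\<eta> < 1" and \<Omega>: "\<Omega> \<in> components (level_set u \<eta>)"
  shows "(INF z\<in>\<Omega>. norm (u z)) = 0"
proof (rule ccontr)
  define \<delta> where "\<delta> = (INF z\<in>\<Omega>. norm (u z))"
  have hol: "u holomorphic_on unit_disk"
    using u by (simp add: inner_function_def H_infinity_def)
  have cu: "continuous_on unit_disk u" by (rule holomorphic_on_imp_continuous_on[OF hol])
  have op: "open \<Omega>" using open_components[OF open_level_set[OF cu] \<Omega>] .
  have ne: "\<Omega> \<noteq> {}" using \<Omega> in_components_nonempty by auto
  have sub: "\<Omega> \<subseteq> level_set u \<eta>" using \<Omega> in_components_subset by blast
  then have subD: "\<Omega> \<subseteq> unit_disk" by (auto simp: level_set_def)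
  assume "(INF z\<in>\<Omega>. norm (u z)) \<noteq> 0"
  moreover have "0 \<le> \<delta>" unfolding \<delta>_def by (rule cINF_greatest[OF ne]) simp
  ultimately have \<delta>: "\<delta> > 0" by (simp add: \<delta>_def)
  have lower: "\<delta> \<le> norm (u z)" if "z \<in> \<Omega>" for z
    unfolding \<delta>_def using that by (intro cINF_lower bdd_belowI2[of _ 0]) auto
  have upper: "norm (u z) < \<eta>" if "z \<in> \<Omega>" for z
    using that sub by (auto simp: level_set_def)
  define v where "v z = (if z \<in> \<Omega> then \<eta> / norm (u z) - 1 else 0)" for z
  have v0: "0 \<le> v z" for z
    using upper[of z] lower[of z] \<delta> by (auto simp: v_def divide_simps)
  have vB: "v z \<le> \<eta> / \<delta>" for z
  proof (cases "z \<in> \<Omega>")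
    case True
    then have "\<eta> / norm (u z) \<le> \<eta> / \<delta>"
      using lower[OF True] \<delta> \<eta> by (intro divide_left_mono mult_pos_pos) auto
    then show ?thesis using True by (simp add: v_def)
  qed (use \<delta> \<eta> in \<open>simp add: v_def\<close>)
  have fr: "norm (u z) = \<eta>" if "z \<in> unit_disk" "z \<in> closure \<Omega>" "z \<notin> \<Omega>" for z
    using that component_frontier_norm[OF cu \<Omega>] op by (simp add: frontier_def interior_open)
  have nz\<Omega>: "u z \<noteq> 0" if "z \<in> \<Omega>" for z using lower[OF that] \<delta> by auto
  have nz: "u z \<noteq> 0" if "z \<in> unit_disk" "z \<in> closure \<Omega>" for z
    using fr[OF that] nz\<Omega>[of z] \<eta> by force
  \<comment> \<open>The two formulas for \<open>v\<close> agree where \<open>\<bar>u\<bar> = \<eta>\<close>, in particular on the common boundary.\<close>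
  have "continuous_on (unit_disk \<inter> closure \<Omega> \<union> (unit_disk - \<Omega>)) v"
    unfolding v_def
  proof (rule continuous_on_cases_local)
    have eq: "unit_disk \<inter> closure \<Omega> \<union> (unit_disk - \<Omega>) = unit_disk"
      using closure_subset by blast
    show "closedin (top_of_set (unit_disk \<inter> closure \<Omega> \<union> (unit_disk - \<Omega>))) (unit_disk \<inter> closure \<Omega>)"
      unfolding eq by (simp add: closedin_closed_Int)
    show "closedin (top_of_set (unit_disk \<inter> closure \<Omega> \<union> (unit_disk - \<Omega>))) (unit_disk - \<Omega>)"
      unfolding eq using op by (simp add: Diff_eq closedin_closed_Int closed_Compl)
    show "continuous_on (unit_disk \<inter> closure \<Omega>) (\<lambda>z. \<eta> / norm (u z) - 1)"
      using nz by (intro continuous_intros continuous_on_subset[OF cu]) auto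
    show "\<eta> / norm (u z) - 1 = 0"
      if "z \<in> unit_disk \<inter> closure \<Omega> \<and> z \<notin> \<Omega> \<or> z \<in> unit_disk - \<Omega> \<and> z \<in> \<Omega>" for z
      using that fr[of z] \<eta> by auto
  qed auto
  moreover have "unit_disk \<inter> closure \<Omega> \<union> (unit_disk - \<Omega>) = unit_disk"
    using closure_subset by blast
  ultimately have cv: "continuous_on unit_disk v" by simp
  \<comment> \<open>On \<open>\<Omega>\<close> a rotated \<open>\<eta>/u - 1\<close> touches \<open>v\<close> from below; off \<open>\<Omega>\<close> the constant \<open>0\<close> does.\<close>
  have hv: "harmonic_minorants v unit_disk"
    unfolding harmonic_minorants_def
  proof
    fix z assume z: "z \<in> unit_disk"
    show "\<exists>e>0. \<exists>F. ball z e \<subseteq> unit_disk \<and> F holomorphic_on ball z e \<and> Re (F z) = v z \<and>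
        (\<forall>w\<in>ball z e. Re (F w) \<le> v w)"
    proof (cases "z \<in> \<Omega>")
      case True
      obtain e where e: "e > 0" "ball z e \<subseteq> \<Omega>"
        using op True open_contains_ball by blast
      \<comment> \<open>The rotation \<open>sgn (u z)\<close> makes \<open>\<eta> / u\<close> positive at the touching point.\<close>
      define F where "F w = sgn (u z) * of_real \<eta> / u w - 1" for w
      have "F holomorphic_on ball z e"
        unfolding F_def using e(2) subD nz\<Omega>
        by (intro holomorphic_intros holomorphic_on_subset[OF hol]) auto
      moreover have "F z = of_real (v z)"
        using True nz\<Omega>[OF True] by (simp add: F_def v_def sgn_eq field_simps)
      moreover have "Re (F w) \<le> v w" if "w \<in> ball z e" for w
      proof -
        have "Re (sgn (u z) * of_real \<eta> / u w) \<le> norm (sgn (u z) * of_real \<eta> / u w)"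
          by (rule complex_Re_le_cmod)
        also have "\<dots> = \<eta> / norm (u w)"
          using nz\<Omega>[OF True] \<eta> by (simp add: norm_mult norm_divide norm_sgn)
        finally show ?thesis using that e(2) by (auto simp: F_def v_def)
      qed
      ultimately show ?thesis
        using e subD by (intro exI[of _ e] conjI exI[of _ F]) auto
    next
      case False
      obtain e where "e > 0" "ball z e \<subseteq> unit_disk"
        using z open_contains_ball open_ball by metis
      then show ?thesis
        using v0 False by (intro exI[of _ e] conjI exI[of _ "\<lambda>_. 0"]) (auto simp: v_def)
    qed
  qed
  have lim: "AE t in lebesgue_on {0..2*pi}. ((\<lambda>r. v (of_real r * cis t)) \<longlongrightarrow> 0) (at_left 1)"
  proof -
    have "AE t in lebesgue_on {0..2*pi}. \<exists>L. has_radial_limit u L t \<and> norm L = 1"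
      using u by (simp add: inner_function_def)
    then show ?thesis
    proof eventually_elim
      case (elim t)
      then obtain L where L: "((\<lambda>r. u (of_real r * cis t)) \<longlongrightarrow> L) (at_left 1)" "norm L = 1"
        by (auto simp: has_radial_limit_def)
      have "eventually (\<lambda>r. norm (u (of_real r * cis t)) > \<eta>) (at_left 1)"
        using order_tendstoD(1)[OF tendsto_norm[OF L(1)]] L(2) \<eta> by simp
      then have "eventually (\<lambda>r. v (of_real r * cis t) = 0) (at_left 1)"
        by eventually_elim (use upper in \<open>force simp: v_def\<close>)
      then show ?case by (rule tendsto_eventually)
    qed
  qed
  obtain z where z: "z \<in> \<Omega>" using ne by auto
  have "v z = 0"
    by (rule radial_limit_zero_imp_zero[OF hv cv _ lim]) (use v0 vB z subD in auto)
  moreover have "v z > 0"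
    using z upper[OF z] lower[OF z] \<delta> by (auto simp: v_def divide_simps)
  ultimately show False by simp
qed

theorem lemma1p1:
  fixes u :: "complex \<Rightarrow> complex" and \<eta> :: real and \<Omega>0 :: "complex set"
  assumes "inner_function u"
    and "\<not> u constant_on unit_disk"
    and "0 < \<eta>" and "\<eta> < 1"
    and "\<Omega>0 \<in> components (level_set u \<eta>)"
  shows "simply_connected_domain \<Omega>0 \<and> (INF z\<in>\<Omega>0. norm (u z)) = 0"
proof
  have "u holomorphic_on unit_disk"
    using assms(1) by (simp add: inner_function_def H_infinity_def)
  then show "simply_connected_domain \<Omega>0"
    using level_set_component_simply_connected assms(2,5) by blast
  show "(INF z\<in>\<Omega>0. norm (u z)) = 0"
    using level_set_component_INF_zero assms(1,3-5) by blast
qed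

end
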